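(* Let $\sigma_0>0$ and let $Y_1,Y_2,\dots$ be i.i.d. with the folded normal density $f(\cdot;0,\sigma_0)$. Define $r_6(t):=\log(2\cosh t)-\log2-\frac{t^2}{2}+\frac{t^4}{12}$ for $t\in\mathbb{R}$, and $$R_n(\mu):=\sum_{i=1}^nr_6\!\Big(\frac{Y_i\mu}{\sigma_0^2}\Big),\qquad\mu\in\mathbb{R}.$$ Fix $u<\infty$. Then $\mathbb{E}[Y^6]<\infty$ and $$\sup_{|\mu|\le un^{-1/4}}|R_n(\mu)|=O_p(n^{-1/2}).$$ In particular, uniformly over $|\mu|\le un^{-1/4}$, $R_n(\mu)=o_p(1)$ and $R_n(\mu)=o_p(n\mu^4)$.
   Context: The folded normal density is $f(y;\mu,\sigma)=\frac1\sigma\{\varphi(\frac{y-\mu}{\sigma})+\varphi(\frac{y+\mu}{\sigma})\}$ for $y\ge0$, with $\varphi(z)=(2\pi)^{-1/2}e^{-z^2/2}$; so $Y$ is distributed as $|N(0,\sigma_0^2)|$. $O_p$ and $o_p$ are the usual stochastic order symbols as $n\to\infty$; "$R_n(\mu)=o_p(n\mu^4)$ uniformly" means $\sup_{0<|\mu|\le un^{-1/4}}|R_n(\mu)|/(n\mu^4)\to0$ in probability (and $R_n(0)=0$). With $\ell_n(\mu,\sigma_0)=\sum_i\log f(Y_i;\mu,\sigma_0)$, the quantity $R_n(\mu)$ is the remainder in $\ell_n(\mu,\sigma_0)-\ell_n(0,\sigma_0)=\frac{\mu^2}{2\sigma_0^4}\sum_i(Y_i^2-\sigma_0^2)-\frac{\mu^4}{12\sigma_0^8}\sum_iY_i^4+R_n(\mu)$.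 *)

theory Defs
  imports "HOL-Probability.Probability"
begin

text \<open>The density is extended by \<open>0\<close> to the negative half-line, so that it can be used as a density
  with respect to Lebesgue measure on the whole real line.\<close>

definition folded_normal_density :: "real \<Rightarrow> real \<Rightarrow> real \<Rightarrow> real" where
  "folded_normal_density \<mu> \<sigma> y =
     (if y \<ge> 0
      then 1 / \<sigma> * (std_normal_density ((y - \<mu>) / \<sigma>) + std_normal_density ((y + \<mu>) / \<sigma>))
      else 0)"

definition r6 :: "real \<Rightarrow> real" where
  "r6 t = ln (2 * cosh t) - ln 2 - t ^ 2 / 2 + t ^ 4 / 12"

definition R_rem :: "real \<Rightarrow> (nat \<Rightarrow> 'a \<Rightarrow> real) \<Rightarrow> nat \<Rightarrow> real \<Rightarrow> 'a \<Rightarrow> real" where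
  "R_rem \<sigma> Y n \<mu> \<omega> = (\<Sum>i=1..n. r6 (Y i \<omega> * \<mu> / \<sigma>\<^sup>2))"

text \<open>Stochastic order symbols \<open>X n = O\<^sub>p(a n)\<close> and \<open>X n = o\<^sub>p(a n)\<close> as \<open>n \<rightarrow> \<infinity>\<close>, for nonnegative
  extended-real random variables \<open>X n\<close> and positive reals \<open>a n\<close>. They are applied to suprema of
  absolute values, which always exist in \<^typ>\<open>ennreal\<close> (the empty supremum being \<open>0\<close>).
  Measurability is part of the definitions, because \<^const>\<open>measure\<close> is \<open>0\<close> on non-measurable sets.\<close>

definition big_O_p :: "'a measure \<Rightarrow> (nat \<Rightarrow> 'a \<Rightarrow> ennreal) \<Rightarrow> (nat \<Rightarrow> real) \<Rightarrow> bool" where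
  "big_O_p M X a \<longleftrightarrow>
     (\<forall>n. X n \<in> borel_measurable M) \<and>
     (\<forall>\<epsilon>>0. \<exists>K>0. \<forall>\<^sub>F n in sequentially.
        measure M {\<omega> \<in> space M. X n \<omega> > ennreal (K * a n)} \<le> \<epsilon>)"

definition small_o_p :: "'a measure \<Rightarrow> (nat \<Rightarrow> 'a \<Rightarrow> ennreal) \<Rightarrow> (nat \<Rightarrow> real) \<Rightarrow> bool" where
  "small_o_p M X a \<longleftrightarrow>
     (\<forall>n. X n \<in> borel_measurable M) \<and>
     (\<forall>\<epsilon>>0. (\<lambda>n. measure M {\<omega> \<in> space M. X n \<omega> > ennreal (\<epsilon> * a n)}) \<longlonglongrightarrow> 0)"

end

theory Submission
  imports Defs
begin

text \<open>Both \<open>r6 t\<close> and \<open>r6 t / t\<^sup>4\<close> are even, and by differentiating they are seen to be nondecreasing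
  for \<open>t > 0\<close>. Hence, for \<open>u > 0\<close>, both suprema are attained at the endpoint \<open>\<mu> = u n\<^sup>-\<^sup>1\<^sup>/\<^sup>4\<close>; in
  particular they are measurable. The bound \<open>r6 t \<le> t\<^sup>6/45\<close> and the finite sixth moment show that the
  expectations of the suprema are \<open>O(n\<^sup>-\<^sup>1\<^sup>/\<^sup>2)\<close>, and Markov's inequality finishes the proof.\<close>

section \<open>Inequalities for tanh on the half-line\<close>

text \<open>Each inequality below compares two functions that agree at 0, so it reduces to comparing
  their derivatives; iterating this lowers the order.\<close>

lemma nonneg_if_deriv_nonneg:
  fixes f f' :: "real \<Rightarrow> real"
  assumes "f 0 = 0" "\<And>x. (f has_real_derivative f' x) (at x)" "\<And>x. x \<ge> 0 \<Longrightarrow> f' x \<ge> 0" "t \<ge> 0"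
  shows "f t \<ge> 0"
  using DERIV_nonneg_imp_nondecreasing[of 0 t f] assms by fastforce

lemma tanh_real_has_derivative [derivative_intros]:
  fixes g :: "real \<Rightarrow> real"
  assumes "(g has_real_derivative d) (at x within S)"
  shows "((\<lambda>x. tanh (g x)) has_real_derivative (1 - tanh (g x) ^ 2) * d) (at x within S)"
  using has_field_derivative_tanh[OF _ assms] by (simp add: cosh_real_nonzero)

lemma tanh_real_square_le_one: "tanh (t::real) ^ 2 \<le> 1"
  using tanh_real_abs[of t] tanh_real_bounds[of t] by (auto simp: abs_square_le_1 abs_le_iff)

lemma tanh_real_le_self:
  assumes "t \<ge> 0" shows "tanh t \<le> (t::real)"
proof -
  have "t - tanh t \<ge> 0"
  proof (rule nonneg_if_deriv_nonneg[where f = "\<lambda>t. t - tanh t" and f' = "\<lambda>t. tanh t ^ 2"])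
    show "((\<lambda>t. t - tanh t) has_real_derivative tanh x ^ 2) (at x)" for x :: real
      by (auto intro!: derivative_eq_intros)
  qed (use assms in auto)
  then show ?thesis by simp
qed

text \<open>The gap between the two sides is the derivative of \<open>r6\<close>, so this bound
  gives the monotonicity of \<open>r6\<close>. Differentiating the gap leads back to tanh t \<le>
  t.\<close>

lemma tanh_real_ge_cubic:
  assumes "t \<ge> 0" shows "tanh t \<ge> (t::real) - t ^ 3 / 3"
proof -
  have "tanh t - t + t ^ 3 / 3 \<ge> 0"
  proof (rule nonneg_if_deriv_nonneg[where f = "\<lambda>t. tanh t - t + t ^ 3 / 3"
      and f' = "\<lambda>t. t ^ 2 - tanh t ^ 2"])
    show "((\<lambda>t. tanh t - t + t ^ 3 / 3) has_real_derivative x ^ 2 - tanh x ^ 2) (at x)" for x :: real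
      by (auto intro!: derivative_eq_intros)
    show "x ^ 2 - tanh x ^ 2 \<ge> 0" if "x \<ge> 0" for x :: real
      using tanh_real_le_self[OF that] that by (simp add: power_mono)
  qed (use assms in auto)
  then show ?thesis by simp
qed

section \<open>Monotonicity and growth of \<open>r6\<close>\<close>

lemma r6_0 [simp]: "r6 0 = 0"
  by (simp add: r6_def)

lemma r6_minus [simp]: "r6 (- t) = r6 t"
  by (simp add: r6_def)

lemma r6_abs [simp]: "r6 \<bar>t\<bar> = r6 t"
  by (simp add: abs_if)

lemma r6_has_derivative: "(r6 has_real_derivative tanh t - t + t ^ 3 / 3) (at t)"
proof -
  have "((\<lambda>t. ln (2 * cosh t) - ln 2 - t ^ 2 / 2 + t ^ 4 / 12) has_real_derivative
          tanh t - t + t ^ 3 / 3) (at t)"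
    by (auto intro!: derivative_eq_intros simp: cosh_real_pos tanh_def)
  then show ?thesis by (simp add: r6_def[abs_def])
qed

lemma r6_mono:
  assumes "0 \<le> s" "s \<le> t" shows "r6 s \<le> r6 t"
proof (rule DERIV_nonneg_imp_nondecreasing[OF assms(2)])
  fix x assume "s \<le> x"
  then have "tanh x - x + x ^ 3 / 3 \<ge> 0"
    using tanh_real_ge_cubic[of x] assms by simp
  then show "\<exists>y. (r6 has_real_derivative y) (at x) \<and> 0 \<le> y"
    using r6_has_derivative by blast
qed

lemma r6_nonneg: "r6 t \<ge> 0"
  using r6_mono[of 0 "\<bar>t\<bar>"] by simp

text \<open>t^6/45 is the leading Taylor term of \<open>r6\<close> at 0. Two differentiations reduce
  the bound to x^2 - tanh^2 x \<le> (2/3) x^4.\<close>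

lemma r6_le: "r6 t \<le> t ^ 6 / 45"
proof -
  have deriv2: "2 / 3 * x ^ 4 - (x ^ 2 - tanh x ^ 2) \<ge> 0" if "x \<ge> 0" for x :: real
  proof -
    have "x ^ 2 - tanh x ^ 2 = (x - tanh x) * (x + tanh x)"
      by (simp add: power2_eq_square algebra_simps)
    \<comment> \<open>The cubic lower bound on tanh controls the first factor, tanh x \<le> x the
      second.\<close>
    also have "\<dots> \<le> (x ^ 3 / 3) * (2 * x)"
      using tanh_real_le_self[OF that] tanh_real_ge_cubic[OF that] that
      by (intro mult_mono) auto
    finally show ?thesis by (simp add: eval_nat_numeral)
  qed
  have deriv1: "2 / 15 * x ^ 5 - (tanh x - x + x ^ 3 / 3) \<ge> 0" if "x \<ge> 0" for x :: real
  proof (rule nonneg_if_deriv_nonneg[OF _ _ deriv2 that])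
    show "((\<lambda>x. 2 / 15 * x ^ 5 - (tanh x - x + x ^ 3 / 3)) has_real_derivative
            2 / 3 * x ^ 4 - (x ^ 2 - tanh x ^ 2)) (at x)" for x :: real
      by (auto intro!: derivative_eq_intros)
  qed auto
  \<comment> \<open>Both sides are even, so the half-line suffices.\<close>
  have "\<bar>t\<bar> ^ 6 / 45 - r6 \<bar>t\<bar> \<ge> 0"
  proof (rule nonneg_if_deriv_nonneg[where f = "\<lambda>x. x ^ 6 / 45 - r6 x", OF _ _ deriv1])
    show "((\<lambda>x. x ^ 6 / 45 - r6 x) has_real_derivative
            2 / 15 * x ^ 5 - (tanh x - x + x ^ 3 / 3)) (at x)" for x :: real
      by (auto intro!: derivative_eq_intros r6_has_derivative)
  qed auto
  then show ?thesis by simp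
qed

text \<open>Equivalent to \<open>(r6 t / t\<^sup>4)' \<ge> 0\<close>. It is reached by differentiating three times;
  the last derivative is \<open>2 tanh t (tanh t - t (1 - tanh\<^sup>2 t))\<close>.\<close>

lemma four_r6_le:
  assumes "t \<ge> 0" shows "4 * r6 t \<le> t * (tanh t - t + t ^ 3 / 3)"
proof -
  \<comment> \<open>The nontrivial factor of the last derivative vanishes at 0 and is itself
    nondecreasing on the half-line.\<close>
  have d4: "tanh x - x * (1 - tanh x ^ 2) \<ge> 0" if "x \<ge> 0" for x :: real
  proof (rule nonneg_if_deriv_nonneg[where f = "\<lambda>x. tanh x - x * (1 - tanh x ^ 2)", OF _ _ _ that])
    show "((\<lambda>x. tanh x - x * (1 - tanh x ^ 2)) has_real_derivative
            2 * x * tanh x * (1 - tanh x ^ 2)) (at x)" for x :: real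
      by (auto intro!: derivative_eq_intros simp: algebra_simps)
    show "2 * x * tanh x * (1 - tanh x ^ 2) \<ge> 0" if "x \<ge> 0" for x :: real
      using that tanh_real_square_le_one[of x] by simp
  qed auto
  have d3: "2 * tanh x * (tanh x - x * (1 - tanh x ^ 2)) \<ge> 0" if "x \<ge> 0" for x :: real
    using d4[OF that] that by simp
  \<comment> \<open>The second derivative of the difference of the two sides, as the product rule
    delivers it; it expands to the product in \<open>d3\<close>.\<close>
  have d2: "x * (2 * x - 2 * tanh x * (1 - tanh x ^ 2)) - 2 * (x ^ 2 - tanh x ^ 2) \<ge> 0"
    if "x \<ge> 0" for x :: real
    using d3[OF that] by (simp add: power2_eq_square algebra_simps)
  have d1: "x * (x ^ 2 - tanh x ^ 2) - 3 * (tanh x - x + x ^ 3 / 3) \<ge> 0" if "x \<ge> 0" for x :: real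
  proof (rule nonneg_if_deriv_nonneg[OF _ _ d2 that])
    show "((\<lambda>x. x * (x ^ 2 - tanh x ^ 2) - 3 * (tanh x - x + x ^ 3 / 3)) has_real_derivative
            x * (2 * x - 2 * tanh x * (1 - tanh x ^ 2)) - 2 * (x ^ 2 - tanh x ^ 2)) (at x)"
      for x :: real
      by (auto intro!: derivative_eq_intros simp: algebra_simps)
  qed auto
  have "t * (tanh t - t + t ^ 3 / 3) - 4 * r6 t \<ge> 0"
  proof (rule nonneg_if_deriv_nonneg[OF _ _ d1 assms])
    show "((\<lambda>x. x * (tanh x - x + x ^ 3 / 3) - 4 * r6 x) has_real_derivative
            x * (x ^ 2 - tanh x ^ 2) - 3 * (tanh x - x + x ^ 3 / 3)) (at x)" for x :: real
      by (auto intro!: derivative_eq_intros r6_has_derivative simp: algebra_simps)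
  qed auto
  then show ?thesis by simp
qed

lemma r6_div_power4_mono:
  assumes "0 < s" "s \<le> t" shows "r6 s / s ^ 4 \<le> r6 t / t ^ 4"
proof (rule DERIV_nonneg_imp_nondecreasing[OF assms(2), where f = "\<lambda>x. r6 x / x ^ 4"])
  fix x assume "s \<le> x"
  then have x: "x > 0" using assms by simp
  \<comment> \<open>The quotient rule with x^3 factored out: the sign is that of the bracket, which
    \<open>four_r6_le\<close> controls.\<close>
  let ?d = "x ^ 3 * (x * (tanh x - x + x ^ 3 / 3) - 4 * r6 x) / (x ^ 4 * x ^ 4)"
  have "((\<lambda>x. r6 x / x ^ 4) has_real_derivative
      ((tanh x - x + x ^ 3 / 3) * x ^ 4 - r6 x * (4 * x ^ 3)) / (x ^ 4 * x ^ 4)) (at x)"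
    using x by (auto intro!: derivative_eq_intros r6_has_derivative)
  moreover have "(tanh x - x + x ^ 3 / 3) * x ^ 4 - r6 x * (4 * x ^ 3) =
      x ^ 3 * (x * (tanh x - x + x ^ 3 / 3) - 4 * r6 x)"
    by (simp add: eval_nat_numeral algebra_simps)
  ultimately have "((\<lambda>x. r6 x / x ^ 4) has_real_derivative ?d) (at x)"
    by simp
  moreover have "?d \<ge> 0"
    using x four_r6_le[of x] by simp
  ultimately show "\<exists>y. ((\<lambda>x. r6 x / x ^ 4) has_real_derivative y) (at x) \<and> 0 \<le> y"
    by blast
qed

text \<open>Prepares the summands of \<open>R_rem\<close>, where a is
  \<open>Y i \<omega> / \<sigma>\<^sup>2\<close>. Rescaling by \<bar>a\<bar> costs only the constant
  factor a^4, and evenness of \<open>r6\<close> removes the sign of a.\<close>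

lemma r6_scaled_div_power4_mono:
  assumes "0 < s" "s \<le> t" shows "r6 (a * s) / s ^ 4 \<le> r6 (a * t) / t ^ 4"
proof (cases "a = 0")
  case False
  then have "\<bar>a\<bar> ^ 4 * (r6 (\<bar>a\<bar> * s) / (\<bar>a\<bar> * s) ^ 4) \<le> \<bar>a\<bar> ^ 4 * (r6 (\<bar>a\<bar> * t) / (\<bar>a\<bar> * t) ^ 4)"
    using assms by (intro mult_left_mono r6_div_power4_mono) auto
  moreover have "r6 (\<bar>a\<bar> * x) = r6 (a * x)" for x
    by (metis abs_mult abs_abs r6_abs)
  ultimately show ?thesis
    using False by (simp add: power_mult_distrib)
qed simp

lemma borel_measurable_r6 [measurable]: "r6 \<in> borel_measurable borel"
  by (intro borel_measurable_continuous_onI continuous_at_imp_continuous_on ballI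
      DERIV_isCont[OF r6_has_derivative])

section \<open>Pathwise control of the remainder and its suprema\<close>

lemma R_rem_0 [simp]: "R_rem \<sigma> Y n 0 \<omega> = 0"
  by (simp add: R_rem_def)

lemma R_rem_nonneg: "R_rem \<sigma> Y n \<mu> \<omega> \<ge> 0"
  by (simp add: R_rem_def sum_nonneg r6_nonneg)

lemma R_rem_abs: "R_rem \<sigma> Y n \<bar>\<mu>\<bar> \<omega> = R_rem \<sigma> Y n \<mu> \<omega>"
  by (simp add: R_rem_def abs_if)

lemma R_rem_mono:
  assumes "0 \<le> s" "s \<le> t" shows "R_rem \<sigma> Y n s \<omega> \<le> R_rem \<sigma> Y n t \<omega>"
  unfolding R_rem_def
proof (rule sum_mono)
  fix i
  \<comment> \<open>Pointwise in \<omega> the sign of \<open>Y i \<omega>\<close> is arbitrary,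
    hence the absolute values.\<close>
  have "r6 \<bar>Y i \<omega> * s / \<sigma>\<^sup>2\<bar> \<le> r6 \<bar>Y i \<omega> * t / \<sigma>\<^sup>2\<bar>"
    using assms by (intro r6_mono) (auto simp: abs_mult intro!: divide_right_mono mult_left_mono)
  then show "r6 (Y i \<omega> * s / \<sigma>\<^sup>2) \<le> r6 (Y i \<omega> * t / \<sigma>\<^sup>2)"
    by (simp only: r6_abs)
qed

lemma R_rem_div_power4_mono:
  assumes "0 < s" "s \<le> t" shows "R_rem \<sigma> Y n s \<omega> / s ^ 4 \<le> R_rem \<sigma> Y n t \<omega> / t ^ 4"
  unfolding R_rem_def sum_divide_distrib
  using r6_scaled_div_power4_mono[OF assms, of "Y i \<omega> / \<sigma>\<^sup>2" for i] by (intro sum_mono) simp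

text \<open>Separates the deterministic scale from the data: only the sum of sixth powers remains
  random. The power 12 comes from \<open>(\<sigma>\<^sup>2) ^ 6\<close>.\<close>

lemma R_rem_le: "R_rem \<sigma> Y n \<mu> \<omega> \<le> \<mu> ^ 6 / (45 * \<sigma> ^ 12) * (\<Sum>i=1..n. Y i \<omega> ^ 6)"
proof -
  have "R_rem \<sigma> Y n \<mu> \<omega> \<le> (\<Sum>i=1..n. (Y i \<omega> * \<mu> / \<sigma>\<^sup>2) ^ 6 / 45)"
    unfolding R_rem_def by (intro sum_mono r6_le)
  also have "\<dots> = \<mu> ^ 6 / (45 * \<sigma> ^ 12) * (\<Sum>i=1..n. Y i \<omega> ^ 6)"
    by (simp add: sum_distrib_left sum_divide_distrib power_mult_distrib power_divide mult.commute
        flip: power_mult)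
  finally show ?thesis .
qed

text \<open>Evenness and monotonicity turn an uncountable supremum into a single random variable,
  for every \<omega>.\<close>

lemma SUP_R_rem_eq:
  assumes "c \<ge> 0"
  shows "(SUP \<mu>\<in>{\<mu>. \<bar>\<mu>\<bar> \<le> c}. ennreal \<bar>R_rem \<sigma> Y n \<mu> \<omega>\<bar>) = ennreal (R_rem \<sigma> Y n c \<omega>)"
proof (rule antisym)
  have "R_rem \<sigma> Y n \<mu> \<omega> \<le> R_rem \<sigma> Y n c \<omega>" if "\<bar>\<mu>\<bar> \<le> c" for \<mu>
    using R_rem_mono[of "\<bar>\<mu>\<bar>" c \<sigma> Y n \<omega>] that by (simp add: R_rem_abs)
  then show "(SUP \<mu>\<in>{\<mu>. \<bar>\<mu>\<bar> \<le> c}. ennreal \<bar>R_rem \<sigma> Y n \<mu> \<omega>\<bar>) \<le> ennreal (R_rem \<sigma> Y n c \<omega>)"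
    by (auto intro!: SUP_least ennreal_leI simp: R_rem_nonneg)
  show "ennreal (R_rem \<sigma> Y n c \<omega>) \<le> (SUP \<mu>\<in>{\<mu>. \<bar>\<mu>\<bar> \<le> c}. ennreal \<bar>R_rem \<sigma> Y n \<mu> \<omega>\<bar>)"
    using assms by (intro SUP_upper2[of c]) (auto simp: R_rem_nonneg)
qed

text \<open>As for the unweighted supremum, but the range is punctured at 0, so the endpoint belongs
  to it only for c > 0. For n = 0 both sides are 0, since division by 0 yields 0.\<close>

lemma SUP_R_rem_div_eq:
  assumes "c > 0"
  shows "(SUP \<mu>\<in>{\<mu>. 0 < \<bar>\<mu>\<bar> \<and> \<bar>\<mu>\<bar> \<le> c}. ennreal (\<bar>R_rem \<sigma> Y n \<mu> \<omega>\<bar> / (real n * \<mu> ^ 4))) =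
    ennreal (R_rem \<sigma> Y n c \<omega> / (real n * c ^ 4))" (is "?S = ?r")
proof (rule antisym)
  have "R_rem \<sigma> Y n \<mu> \<omega> / (real n * \<mu> ^ 4) \<le> R_rem \<sigma> Y n c \<omega> / (real n * c ^ 4)"
    if "\<mu> \<noteq> 0" "\<bar>\<mu>\<bar> \<le> c" for \<mu>
    using divide_right_mono[OF R_rem_div_power4_mono[of "\<bar>\<mu>\<bar>" c \<sigma> Y n \<omega>], of "real n"] that
    by (simp add: R_rem_abs mult.commute)
  then show "?S \<le> ?r"
    by (auto intro!: SUP_least ennreal_leI simp: R_rem_nonneg)
  show "?r \<le> ?S"
    using assms by (intro SUP_upper2[of c]) (auto simp: R_rem_nonneg)
qed

section \<open>Measurability and moments\<close>

lemma borel_measurable_R_rem: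
  assumes "\<And>i. i \<ge> 1 \<Longrightarrow> Y i \<in> borel_measurable M"
  shows "(\<lambda>\<omega>. R_rem \<sigma> Y n \<mu> \<omega>) \<in> borel_measurable M"
  unfolding R_rem_def
proof (rule borel_measurable_sum)
  fix i assume "i \<in> {1..n}"
  then have [measurable]: "Y i \<in> borel_measurable M" using assms by simp
  show "(\<lambda>\<omega>. r6 (Y i \<omega> * \<mu> / \<sigma>\<^sup>2)) \<in> borel_measurable M" by measurable
qed

text \<open>The sixth-power bound, integrated by linearity: n summands, each of mean m.\<close>

lemma nn_integral_R_rem_le:
  assumes int: "\<And>i. i \<ge> 1 \<Longrightarrow> integrable M (\<lambda>\<omega>. Y i \<omega> ^ 6)"
    and mean: "\<And>i. i \<ge> 1 \<Longrightarrow> (LINT \<omega>|M. Y i \<omega> ^ 6) = m"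
  shows "(\<integral>\<^sup>+\<omega>. ennreal (R_rem \<sigma> Y n \<mu> \<omega>) \<partial>M) \<le> ennreal (real n * \<mu> ^ 6 * m / (45 * \<sigma> ^ 12))"
proof -
  let ?g = "\<lambda>\<omega>. \<mu> ^ 6 / (45 * \<sigma> ^ 12) * (\<Sum>i=1..n. Y i \<omega> ^ 6)"
  have "(\<integral>\<^sup>+\<omega>. ennreal (R_rem \<sigma> Y n \<mu> \<omega>) \<partial>M) \<le> (\<integral>\<^sup>+\<omega>. ennreal (?g \<omega>) \<partial>M)"
    by (intro nn_integral_mono ennreal_leI R_rem_le)
  also have "\<dots> = ennreal (LINT \<omega>|M. ?g \<omega>)"
    using int by (intro nn_integral_eq_integral AE_I2 mult_nonneg_nonneg sum_nonneg
      integrable_mult_right integrable_sum) auto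
  also have "(LINT \<omega>|M. ?g \<omega>) = real n * \<mu> ^ 6 * m / (45 * \<sigma> ^ 12)"
    using int mean by (simp add: Bochner_Integration.integral_sum)
  finally show ?thesis .
qed

lemma folded_normal_sixth_moment:
  assumes "distributed M lborel X (folded_normal_density 0 \<sigma>)" "\<sigma> > 0"
  shows "integrable M (\<lambda>\<omega>. X \<omega> ^ 6)"
    and "(LINT \<omega>|M. X \<omega> ^ 6) = (LINT x|lborel. folded_normal_density 0 \<sigma> x * x ^ 6)"
proof -
  \<comment> \<open>At \<mu> = 0 the two bumps coincide, so the density is twice the centred normal
    one on the half-line and inherits its moments.\<close>
  have density: "folded_normal_density 0 \<sigma> x = indicator {0..} x * (2 * normal_density 0 \<sigma> x)" for x
    using assms(2)
    by (simp add: folded_normal_density_def normal_density_def indicator_def real_sqrt_mult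
        power_divide mult_ac)
  then have nonneg: "folded_normal_density 0 \<sigma> x \<ge> 0" for x
    by (simp add: normal_density_nonneg)
  have "integrable lborel (\<lambda>x. indicator {0..} x *\<^sub>R (2 * (normal_density 0 \<sigma> x * (x - 0) ^ 6)))"
    using assms(2) by (intro integrable_mult_indicator integrable_mult_right integrable_normal_moment) auto
  then have "integrable lborel (\<lambda>x. folded_normal_density 0 \<sigma> x * x ^ 6)"
    by (simp add: density mult_ac)
  then show "integrable M (\<lambda>\<omega>. X \<omega> ^ 6)"
    using distributed_integrable[OF assms(1), of "\<lambda>x. x ^ 6"] nonneg by simp
  show "(LINT \<omega>|M. X \<omega> ^ 6) = (LINT x|lborel. folded_normal_density 0 \<sigma> x * x ^ 6)"
    using distributed_integral[OF assms(1), of "\<lambda>x. x ^ 6"] nonneg by simp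
qed

section \<open>Stochastic orders from expectations\<close>

text \<open>Markov's inequality. Positivity is asked only eventually because the rate
  \<open>real n powr (-1/2)\<close> is 0 at n = 0.\<close>

lemma (in prob_space) big_O_pI_expectation:
  assumes meas: "\<And>n. X n \<in> borel_measurable M"
    and pos: "\<forall>\<^sub>F n in sequentially. a n > 0"
    and bound: "\<forall>\<^sub>F n in sequentially. (\<integral>\<^sup>+\<omega>. X n \<omega> \<partial>M) \<le> ennreal (C * a n)"
  shows "big_O_p M X a"
  unfolding big_O_p_def
proof (intro conjI allI impI)
  fix \<epsilon> :: real assume \<epsilon>: "\<epsilon> > 0"
  \<comment> \<open>Chosen so that K \<epsilon> = \<bar>C\<bar> + 1; this numerator keeps K positive
    for every real C.\<close>
  define K where "K = (\<bar>C\<bar> + 1) / \<epsilon>"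
  have K: "K > 0" using \<epsilon> by (simp add: K_def)
  have "\<forall>\<^sub>F n in sequentially. measure M {\<omega> \<in> space M. X n \<omega> > ennreal (K * a n)} \<le> \<epsilon>"
    using pos bound
  proof eventually_elim
    case (elim n)
    let ?A = "{\<omega> \<in> space M. X n \<omega> > ennreal (K * a n)}"
    have [measurable]: "X n \<in> borel_measurable M" by (rule meas)
    have A: "?A \<in> sets M" by measurable
    \<comment> \<open>Markov's inequality by hand: on \<open>?A\<close> the constant K a(n) lies
      below X(n).\<close>
    have "ennreal (K * a n * measure M ?A) = (\<integral>\<^sup>+\<omega>. ennreal (K * a n) * indicator ?A \<omega> \<partial>M)"
      using A K elim by (simp add: nn_integral_cmult_indicator emeasure_eq_measure ennreal_mult)
    also have "\<dots> \<le> (\<integral>\<^sup>+\<omega>. X n \<omega> \<partial>M)"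
      by (intro nn_integral_mono) (auto simp: indicator_def)
    also have "\<dots> \<le> ennreal (C * a n)" by (rule elim)
    also have "\<dots> \<le> ennreal ((\<bar>C\<bar> + 1) * a n)"
      using elim by (intro ennreal_leI mult_right_mono) auto
    finally have "K * a n * measure M ?A \<le> (\<bar>C\<bar> + 1) * a n"
      using elim by (subst (asm) ennreal_le_iff) auto
    then have "(K * measure M ?A) * a n \<le> (K * \<epsilon>) * a n"
      using \<epsilon> by (simp add: K_def mult_ac)
    then show ?case
      using elim K by simp
  qed
  with K show "\<exists>K>0. \<forall>\<^sub>F n in sequentially. measure M {\<omega> \<in> space M. X n \<omega> > ennreal (K * a n)} \<le> \<epsilon>"
    by blast
qed (rule meas)

text \<open>Once K a(n) < \<epsilon>, exceeding \<epsilon> forces exceeding K a(n), whose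
  probability is already controlled.\<close>

lemma (in prob_space) small_o_pI_big_O_p:
  assumes "big_O_p M X a" "a \<longlonglongrightarrow> 0"
  shows "small_o_p M X (\<lambda>_. 1)"
  unfolding small_o_p_def
proof (intro conjI allI impI)
  show meas: "X n \<in> borel_measurable M" for n
    using assms(1) by (simp add: big_O_p_def)
  fix \<epsilon> :: real assume \<epsilon>: "\<epsilon> > 0"
  show "(\<lambda>n. measure M {\<omega> \<in> space M. X n \<omega> > ennreal (\<epsilon> * 1)}) \<longlonglongrightarrow> 0"
  proof (rule LIMSEQ_I)
    fix r :: real assume r: "r > 0"
    \<comment> \<open>Tolerance r/2 leaves room for the strict inequality in the limit.\<close>
    then obtain K where K: "K > 0"
      and ev: "\<forall>\<^sub>F n in sequentially. measure M {\<omega> \<in> space M. X n \<omega> > ennreal (K * a n)} \<le> r / 2"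
      using assms(1) unfolding big_O_p_def by (meson half_gt_zero)
    have "\<forall>\<^sub>F n in sequentially. a n < \<epsilon> / K"
      using assms(2) \<epsilon> K by (intro order_tendstoD) auto
    then have "\<forall>\<^sub>F n in sequentially. measure M {\<omega> \<in> space M. X n \<omega> > ennreal (\<epsilon> * 1)} < r"
      using ev
    proof eventually_elim
      case (elim n)
      have [measurable]: "X n \<in> borel_measurable M" by (rule meas)
      have "ennreal (K * a n) \<le> ennreal \<epsilon>"
        using elim K by (intro ennreal_leI) (simp add: field_simps)
      then have "measure M {\<omega> \<in> space M. X n \<omega> > ennreal (\<epsilon> * 1)} \<le>
          measure M {\<omega> \<in> space M. X n \<omega> > ennreal (K * a n)}"
        by (intro finite_measure_mono) auto
      with elim r show ?case by simp
    qed
    then show "\<exists>N. \<forall>n\<ge>N. norm (measure M {\<omega> \<in> space M. X n \<omega> > ennreal (\<epsilon> * 1)} - 0) < r"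
      by (simp add: eventually_sequentially)
  qed
qed

section \<open>Rates of both suprema for folded normal data\<close>

theorem lemmaD3:
  fixes M :: "'a measure" and Y :: "nat \<Rightarrow> 'a \<Rightarrow> real" and \<sigma>\<^sub>0 u :: real
  assumes "prob_space M"
    and "\<sigma>\<^sub>0 > 0"
    and "prob_space.indep_vars M (\<lambda>_. borel) Y {1..}"
    and "\<And>i. i \<ge> 1 \<Longrightarrow> distributed M lborel (Y i) (folded_normal_density 0 \<sigma>\<^sub>0)"
  shows "(\<forall>i\<ge>1. integrable M (\<lambda>\<omega>. Y i \<omega> ^ 6)) \<and>
    big_O_p M
      (\<lambda>n \<omega>. SUP \<mu>\<in>{\<mu>. \<bar>\<mu>\<bar> \<le> u * real n powr (-1/4)}. ennreal \<bar>R_rem \<sigma>\<^sub>0 Y n \<mu> \<omega>\<bar>)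
      (\<lambda>n. real n powr (-1/2)) \<and>
    small_o_p M
      (\<lambda>n \<omega>. SUP \<mu>\<in>{\<mu>. \<bar>\<mu>\<bar> \<le> u * real n powr (-1/4)}. ennreal \<bar>R_rem \<sigma>\<^sub>0 Y n \<mu> \<omega>\<bar>)
      (\<lambda>_. 1) \<and>
    small_o_p M
      (\<lambda>n \<omega>. SUP \<mu>\<in>{\<mu>. 0 < \<bar>\<mu>\<bar> \<and> \<bar>\<mu>\<bar> \<le> u * real n powr (-1/4)}.
         ennreal (\<bar>R_rem \<sigma>\<^sub>0 Y n \<mu> \<omega>\<bar> / (real n * \<mu> ^ 4)))
      (\<lambda>_. 1) \<and>
    (\<forall>n \<omega>. R_rem \<sigma>\<^sub>0 Y n 0 \<omega> = 0)"
proof -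
  interpret prob_space M by fact
  \<comment> \<open>The radius may be negative (u < 0) or zero (u = 0 or n = 0), so empty ranges are
    treated separately; their supremum is 0.\<close>
  define c where "c n = u * real n powr (-1/4)" for n
  define m where "m = (LINT x|lborel. folded_normal_density 0 \<sigma>\<^sub>0 x * x ^ 6)"
  let ?a = "\<lambda>n. real n powr (-1/2)"
  let ?X = "\<lambda>n \<omega>. SUP \<mu>\<in>{\<mu>. \<bar>\<mu>\<bar> \<le> c n}. ennreal \<bar>R_rem \<sigma>\<^sub>0 Y n \<mu> \<omega>\<bar>"
  let ?Z = "\<lambda>n \<omega>. SUP \<mu>\<in>{\<mu>. 0 < \<bar>\<mu>\<bar> \<and> \<bar>\<mu>\<bar> \<le> c n}.
    ennreal (\<bar>R_rem \<sigma>\<^sub>0 Y n \<mu> \<omega>\<bar> / (real n * \<mu> ^ 4))"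
  have int: "integrable M (\<lambda>\<omega>. Y i \<omega> ^ 6)" and mean: "(LINT \<omega>|M. Y i \<omega> ^ 6) = m" if "i \<ge> 1" for i
    using folded_normal_sixth_moment[OF assms(4)[OF that] assms(2)] by (auto simp: m_def)
  have [measurable]: "(\<lambda>\<omega>. R_rem \<sigma>\<^sub>0 Y n \<mu> \<omega>) \<in> borel_measurable M" for n \<mu>
    using distributed_measurable[OF assms(4)] by (intro borel_measurable_R_rem) simp
  have X_neg: "?X n \<omega> = 0" if "c n < 0" for n \<omega>
  proof -
    have "{\<mu>. \<bar>\<mu>\<bar> \<le> c n} = {}" using that by auto
    then show ?thesis by (simp add: bot_ennreal)
  qed
  have Z_nonpos: "?Z n \<omega> = 0" if "c n \<le> 0" for n \<omega>
  proof -
    have "{\<mu>. 0 < \<bar>\<mu>\<bar> \<and> \<bar>\<mu>\<bar> \<le> c n} = {}" using that by auto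
    then show ?thesis by (simp only: image_empty Sup_empty bot_ennreal)
  qed
  have X_meas: "?X n \<in> borel_measurable M" for n
    by (cases "c n \<ge> 0") (simp_all only: SUP_R_rem_eq X_neg not_le, measurable)
  have Z_meas: "?Z n \<in> borel_measurable M" for n
    by (cases "c n > 0") (simp_all only: SUP_R_rem_div_eq Z_nonpos not_less, measurable)
  have a_pos: "\<forall>\<^sub>F n in sequentially. ?a n > 0"
    using eventually_gt_at_top[of 0] by eventually_elim simp
  have c2: "c n ^ 2 = u ^ 2 * ?a n" if "n > 0" for n
    using that by (simp add: c_def power_mult_distrib powr_power)
  \<comment> \<open>Origin of the rate: n times n^(-6/4) is n^(-1/2).\<close>
  have c6: "real n * c n ^ 6 = u ^ 6 * ?a n" if "n > 0" for n
  proof -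
    have "real n * real n powr (-3/2) = ?a n"
      using that powr_mult_base[of "real n" "-3/2"] by simp
    then show ?thesis
      using that by (simp add: c_def power_mult_distrib powr_power mult_ac)
  qed
  have "\<forall>\<^sub>F n in sequentially. (\<integral>\<^sup>+\<omega>. ?X n \<omega> \<partial>M) \<le> ennreal (u ^ 6 * m / (45 * \<sigma>\<^sub>0 ^ 12) * ?a n)"
    using eventually_gt_at_top[of 0]
  proof eventually_elim
    case (elim n)
    show ?case
    proof (cases "c n \<ge> 0")
      case True
      have "real n * c n ^ 6 * m / (45 * \<sigma>\<^sub>0 ^ 12) = u ^ 6 * m / (45 * \<sigma>\<^sub>0 ^ 12) * ?a n"
        by (simp add: c6[OF elim])
      then show ?thesis
        using nn_integral_R_rem_le[where \<sigma> = \<sigma>\<^sub>0 and n = n and \<mu> = "c n", OF int mean] True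
        by (simp only: SUP_R_rem_eq)
    qed (simp only: X_neg not_le nn_integral_const mult_zero_left zero_le)
  qed
  then have X: "big_O_p M ?X ?a"
    by (rule big_O_pI_expectation[OF X_meas a_pos])
  \<comment> \<open>The weighted supremum has the same rate: dividing n c^6 by n c^4 leaves c^2, of
    order n^(-1/2).\<close>
  have "\<forall>\<^sub>F n in sequentially. (\<integral>\<^sup>+\<omega>. ?Z n \<omega> \<partial>M) \<le> ennreal (u ^ 2 * m / (45 * \<sigma>\<^sub>0 ^ 12) * ?a n)"
    using eventually_gt_at_top[of 0]
  proof eventually_elim
    case (elim n)
    show ?case
    proof (cases "c n > 0")
      case True
      let ?k = "inverse (real n * c n ^ 4)"
      have "(\<integral>\<^sup>+\<omega>. ?Z n \<omega> \<partial>M) = (\<integral>\<^sup>+\<omega>. ennreal ?k * ennreal (R_rem \<sigma>\<^sub>0 Y n (c n) \<omega>) \<partial>M)"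
        by (subst SUP_R_rem_div_eq[OF True])
          (simp add: R_rem_nonneg divide_inverse_commute flip: ennreal_mult del: inverse_mult_distrib)
      also have "\<dots> = ennreal ?k * (\<integral>\<^sup>+\<omega>. ennreal (R_rem \<sigma>\<^sub>0 Y n (c n) \<omega>) \<partial>M)"
        by (rule nn_integral_cmult) measurable
      also have "\<dots> \<le> ennreal ?k * ennreal (real n * c n ^ 6 * m / (45 * \<sigma>\<^sub>0 ^ 12))"
        by (intro mult_left_mono nn_integral_R_rem_le int mean) auto
      also have "\<dots> = ennreal (?k * (real n * c n ^ 6 * m / (45 * \<sigma>\<^sub>0 ^ 12)))"
        by (rule ennreal_mult'[symmetric]) simp
      also have "?k * (real n * c n ^ 6 * m / (45 * \<sigma>\<^sub>0 ^ 12)) = c n ^ 2 * m / (45 * \<sigma>\<^sub>0 ^ 12)"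
        using True elim by (simp add: field_simps eval_nat_numeral)
      also have "\<dots> = u ^ 2 * m / (45 * \<sigma>\<^sub>0 ^ 12) * ?a n"
        by (simp add: c2[OF elim])
      finally show ?thesis .
    qed (simp only: Z_nonpos not_less nn_integral_const mult_zero_left zero_le)
  qed
  then have Z: "big_O_p M ?Z ?a"
    by (rule big_O_pI_expectation[OF Z_meas a_pos])
  have a_lim: "?a \<longlonglongrightarrow> 0"
    by (rule tendsto_neg_powr) (auto intro: filterlim_real_sequentially)
  \<comment> \<open>Both o_p claims follow from O_p(n^(-1/2)); the one relative to n \<mu>^4 is
    o_p(1) for the weighted supremum.\<close>
  show ?thesis
    using int X small_o_pI_big_O_p[OF X a_lim] small_o_pI_big_O_p[OF Z a_lim]
    unfolding c_def by simp
qed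

end
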